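(* Let $A\in\mathbb{R}^{n\times n}$, $B\in\mathbb{R}^{n\times p}$ and shifts $\tau_1,\ldots,\tau_\nu\in\mathbb{C}$ be such that $A$ and all $A-\tau_iI$ are nonsingular, and consider the preconditioned block systems $(I-\tau_iA^{-1})Y_i=B$, $i=1,\ldots,\nu$. Let $\mathcal{V}_m,\mathcal{H}_m,\widetilde{\mathcal{H}}_m,H_{m+1,m}$ come from the block Arnoldi relation for $A^{-1}$, let $\widehat{Y}_i^0$ be initial guesses common to both methods with residuals $\widehat{R}_i^0=V_1\widehat{R}_i$, and let $\widehat{Y}_i^{FOM}=\widehat{Y}_i^0+\mathcal{V}_m\widehat{Z}_i^{FOM}$ and $\widehat{Y}_i^{GMRES}=\widehat{Y}_i^0+\mathcal{V}_m\widehat{Z}_i^{GMRES}$ be the approximations produced by the preconditioned shifted block FOM and shifted block GMRES methods (all as defined in the context). Assume that $I-\tau_i\mathcal{H}_m$ is nonsingular for $i=1,\ldots,\nu$. Put $$G_1^{GMRES}=\widetilde{E}_1\widehat{R}_1-(\widetilde{I}_m-\tau_1\widetilde{\mathcal{H}}_m)\widehat{Z}_1^{GMRES}\in\mathbb{C}^{(mp+p)\times p},$$ let $\Psi_1$ be its first $mp$ rows and $\Psi_2$ its last $p$ rows, and assume that $\Psi_2$ is nonsingular and that the square matrices $[\,\widetilde{I}_m-\tau_i\widetilde{\mathcal{H}}_m,\ G_1^{GMRES}\,]$ are nonsingular for $i=2,\ldots,\nu$. Define $\Gamma_1=|\tau_1|^2(I-\tau_1\mathcal{H}_m)^{-\mathrm{H}}E_m$,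 $\Gamma_2^{\mathrm T}=H_{m+1,m}^{\mathrm T}H_{m+1,m}E_m^{\mathrm T}$, $\Psi_3^{\mathrm T}=\Psi_2^{-1}H_{m+1,m}E_m^{\mathrm T}$, $$\Omega_1=(I-\tau_1\mathcal{H}_m)^{-1}\Gamma_1\big(I+\Gamma_2^{\mathrm T}(I-\tau_1\mathcal{H}_m)^{-1}\Gamma_1\big)^{-1}\Gamma_2^{\mathrm T},$$ and, for $i=2,\ldots,\nu$, $$\Omega_i=\tau_i(I-\tau_i\mathcal{H}_m)^{-1}\Psi_1\big(I+\tau_i\Psi_3^{\mathrm T}(I-\tau_i\mathcal{H}_m)^{-1}\Psi_1\big)^{-1}\Psi_3^{\mathrm T}.$$ Then $$\widehat{Z}_1^{GMRES}=(I-\Omega_1)\widehat{Z}_1^{FOM}\qquad\text{and}\qquad \widehat{Z}_i^{GMRES}=(I-\Omega_i)\widehat{Z}_i^{FOM},\quad i=2,3,\ldots,\nu.$$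
   Context: Notation: $M^{\mathrm T}$, $M^{\mathrm H}$ are transpose and conjugate transpose, $M^{-\mathrm H}=(M^{\mathrm H})^{-1}$, $\|\cdot\|_F$ is the Frobenius norm, and $I$ is an identity matrix of the appropriate size. $E_j$ ($1\le j\le m$) is the $mp\times p$ matrix consisting of columns $(j-1)p+1,\ldots,jp$ of the $mp\times mp$ identity. $\widetilde{E}_1$ is the $(mp+p)\times p$ matrix consisting of the first $p$ columns of the $(mp+p)\times(mp+p)$ identity. $\widetilde{I}_m$ is the $(mp+p)\times mp$ matrix equal to the $mp\times mp$ identity with $p$ zero rows appended at the bottom. Block Arnoldi relation (exact arithmetic): $V_1\in\mathbb{R}^{n\times p}$ has orthonormal columns; $\mathcal{V}_{m+1}=[V_1,V_2,\ldots,V_{m+1}]=[\mathcal{V}_m,V_{m+1}]\in\mathbb{R}^{n\times(m+1)p}$ has orthonormal columns forming a basis of the block Krylov subspace $\mathrm{span}\{V_1,A^{-1}V_1,\ldots,A^{-m}V_1\}$; and $$A^{-1}\mathcal{V}_m=\mathcal{V}_m\mathcal{H}_m+V_{m+1}H_{m+1,m}E_m^{\mathrm T}=\mathcal{V}_{m+1}\widetilde{\mathcal{H}}_m,$$ where $\mathcal{H}_m\in\mathbb{R}^{mp\times mp}$, $H_{m+1,m}\in\mathbb{R}^{p\times p}$, and $\widetilde{\mathcal{H}}_m\in\mathbb{R}^{(mp+p)\times mp}$ is $\mathcal{H}_m$ with the block row $H_{m+1,m}E_m^{\mathrm T}$ appended at the bottom. Initial residuals: $\widehat{R}_i^0=B-(I-\tau_iA^{-1})\widehat{Y}_i^0=V_1\widehat{R}_i$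 with $\widehat{R}_i\in\mathbb{C}^{p\times p}$ and the same $V_1$ for all $i$. Shifted block FOM: $\widehat{Z}_i^{FOM}=(I-\tau_i\mathcal{H}_m)^{-1}E_1\widehat{R}_i$ for $i=1,\ldots,\nu$. Shifted block GMRES: system $i=1$ is the "seed" system, and $\widehat{Z}_1^{GMRES}$ is the minimizer over $Z\in\mathbb{C}^{mp\times p}$ of $\|\widetilde{E}_1\widehat{R}_1-(\widetilde{I}_m-\tau_1\widetilde{\mathcal{H}}_m)Z\|_F$. For the "additional" systems $i=2,\ldots,\nu$, the residual is forced to be collinear with the seed residual: with $\widehat{R}_i^{GMRES}=B-(I-\tau_iA^{-1})\widehat{Y}_i^{GMRES}$, one requires $\widehat{R}_i^{GMRES}=\widehat{R}_1^{GMRES}W_i$ for some nonsingular $p\times p$ matrix $W_i$. Equivalently, $\widehat{Z}_i^{GMRES}$ and $W_i$ satisfy $$\widetilde{E}_1\widehat{R}_i-(\widetilde{I}_m-\tau_i\widetilde{\mathcal{H}}_m)\widehat{Z}_i^{GMRES}=\big[\widetilde{E}_1\widehat{R}_1-(\widetilde{I}_m-\tau_1\widetilde{\mathcal{H}}_m)\widehat{Z}_1^{GMRES}\big]W_i.$$ *)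

theory Defs
  imports
    Complex_Main
    "Jordan_Normal_Form.Schur_Decomposition"
    "Jordan_Normal_Form.VS_Connect"
begin

abbreviation cmat :: "real mat \<Rightarrow> complex mat" where
  "cmat \<equiv> map_mat complex_of_real"

text \<open>Meaningful only for nonsingular \<open>A\<close>; otherwise the value is the unspecified \<open>the None\<close>.\<close>
definition minv :: "'a::field mat \<Rightarrow> 'a mat" where
  "minv A = the (mat_inverse A)"

definition frob_norm :: "complex mat \<Rightarrow> real" where
  "frob_norm A = sqrt (\<Sum>i<dim_row A. \<Sum>j<dim_col A. (cmod (A $$ (i, j)))\<^sup>2)"

definition append_cols :: "'a::zero mat \<Rightarrow> 'a mat \<Rightarrow> 'a mat" (infixr \<open>@\<^sub>c\<close> 65) where
  "A @\<^sub>c B = four_block_mat A B (0\<^sub>m 0 (dim_col A)) (0\<^sub>m 0 (dim_col B))"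

definition orthonormal_cols :: "real mat \<Rightarrow> bool" where
  "orthonormal_cols A \<longleftrightarrow>
     (\<forall>i<dim_col A. \<forall>j<dim_col A. col A i \<bullet> col A j = (if i = j then 1 else 0))"

text \<open>\<open>block_unit m p j\<close> is \<open>E\<^sub>j\<close>, for \<open>1 \<le> j \<le> m\<close>; the \<open>(mp+p) \<times> p\<close> matrix
  written \<open>E\<^sub>1\<close> with a tilde is \<open>block_unit (Suc m) p 1\<close>.\<close>
definition block_unit :: "nat \<Rightarrow> nat \<Rightarrow> nat \<Rightarrow> 'a::{zero,one} mat" where
  "block_unit m p j = mat (m * p) p (\<lambda>(r, c). 1\<^sub>m (m * p) $$ (r, (j - 1) * p + c))"

definition I_ext :: "nat \<Rightarrow> nat \<Rightarrow> 'a::{zero,one} mat" where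
  "I_ext m p = 1\<^sub>m (m * p) @\<^sub>r 0\<^sub>m p (m * p)"

text \<open>\<open>H_ext m p H h\<close> is the extended matrix \<open>\<H>\<^sub>m\<close> with a tilde, where \<open>h\<close> stands for
  \<open>H\<^bsub>m+1,m\<^esub>\<close>.\<close>
definition H_ext :: "nat \<Rightarrow> nat \<Rightarrow> real mat \<Rightarrow> real mat \<Rightarrow> real mat" where
  "H_ext m p H h = H @\<^sub>r (h * (block_unit m p m)\<^sup>T)"

text \<open>\<open>block_row n V k = [V\<^sub>1, \<dots>, V\<^sub>k]\<close>; the blocks are numbered from 1.\<close>
primrec block_row :: "nat \<Rightarrow> (nat \<Rightarrow> 'a::zero mat) \<Rightarrow> nat \<Rightarrow> 'a mat" where
  "block_row n V 0 = 0\<^sub>m n 0"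
| "block_row n V (Suc k) = block_row n V k @\<^sub>c V (Suc k)"

text \<open>The real span of all columns of \<open>V\<^sub>1, C V\<^sub>1, \<dots>, C\<^sup>m V\<^sub>1\<close>.\<close>
definition block_krylov :: "nat \<Rightarrow> real mat \<Rightarrow> real mat \<Rightarrow> nat \<Rightarrow> real vec set" where
  "block_krylov n C V\<^sub>1 m =
     LinearCombinations.module.span class_ring (module_vec TYPE(real) n)
       (\<Union>j\<le>m. set (cols (C ^\<^sub>m j * V\<^sub>1)))"

definition basis_of_subspace :: "nat \<Rightarrow> real vec set \<Rightarrow> real vec set \<Rightarrow> bool" where
  "basis_of_subspace n W S \<longleftrightarrow>
     vectorspace.basis class_ring (module_vec TYPE(real) n\<lparr>carrier := W\<rparr>) S"

definition block_arnoldi ::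
  "nat \<Rightarrow> nat \<Rightarrow> nat \<Rightarrow> real mat \<Rightarrow> (nat \<Rightarrow> real mat) \<Rightarrow> real mat \<Rightarrow> real mat \<Rightarrow> bool" where
  "block_arnoldi n p m A V H h \<longleftrightarrow>
     (\<forall>j\<in>{1..Suc m}. V j \<in> carrier_mat n p) \<and>
     H \<in> carrier_mat (m * p) (m * p) \<and> h \<in> carrier_mat p p \<and>
     orthonormal_cols (V 1) \<and>
     orthonormal_cols (block_row n V (Suc m)) \<and>
     basis_of_subspace n (block_krylov n (minv A) (V 1) m)
       (set (cols (block_row n V (Suc m)))) \<and>
     minv A * block_row n V m =
       block_row n V m * H + V (Suc m) * h * (block_unit m p m)\<^sup>T \<and>
     minv A * block_row n V m = block_row n V (Suc m) * H_ext m p H h"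

text \<open>Residual of \<open>Y\<close> in the preconditioned system with shift \<open>t\<close>.\<close>
definition residual :: "nat \<Rightarrow> real mat \<Rightarrow> real mat \<Rightarrow> complex \<Rightarrow> complex mat \<Rightarrow> complex mat" where
  "residual n A B t Y = cmat B - (1\<^sub>m n - t \<cdot>\<^sub>m cmat (minv A)) * Y"

definition shifted :: "nat \<Rightarrow> nat \<Rightarrow> real mat \<Rightarrow> complex \<Rightarrow> complex mat" where
  "shifted m p H t = 1\<^sub>m (m * p) - t \<cdot>\<^sub>m cmat H"

definition shifted_ext :: "nat \<Rightarrow> nat \<Rightarrow> real mat \<Rightarrow> real mat \<Rightarrow> complex \<Rightarrow> complex mat" where
  "shifted_ext m p H h t = I_ext m p - t \<cdot>\<^sub>m cmat (H_ext m p H h)"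

text \<open>Here and below, \<open>R\<close> is the \<open>p \<times> p\<close> coefficient of the initial residual \<open>V\<^sub>1 R\<close>.\<close>
definition fom_coeff :: "nat \<Rightarrow> nat \<Rightarrow> real mat \<Rightarrow> complex \<Rightarrow> complex mat \<Rightarrow> complex mat" where
  "fom_coeff m p H t R = minv (shifted m p H t) * block_unit m p 1 * R"

definition small_residual ::
  "nat \<Rightarrow> nat \<Rightarrow> real mat \<Rightarrow> real mat \<Rightarrow> complex \<Rightarrow> complex mat \<Rightarrow> complex mat \<Rightarrow> complex mat" where
  "small_residual m p H h t R Z = block_unit (Suc m) p 1 * R - shifted_ext m p H h t * Z"

definition is_seed_gmres_coeff ::
  "nat \<Rightarrow> nat \<Rightarrow> real mat \<Rightarrow> real mat \<Rightarrow> complex \<Rightarrow> complex mat \<Rightarrow> complex mat \<Rightarrow> bool" where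
  "is_seed_gmres_coeff m p H h t R Z \<longleftrightarrow>
     is_arg_min (\<lambda>X. frob_norm (small_residual m p H h t R X))
       (\<lambda>X. X \<in> carrier_mat (m * p) p) Z"

definition collinear_residuals :: "nat \<Rightarrow> complex mat \<Rightarrow> complex mat \<Rightarrow> bool" where
  "collinear_residuals p S T \<longleftrightarrow> (\<exists>W\<in>carrier_mat p p. invertible_mat W \<and> T = S * W)"

end

theory Submission
  imports Defs
begin

text \<open>Write \<open>S\<^sub>i = I - \<tau>\<^sub>i \<H>\<^sub>m\<close> and \<open>L = H\<^bsub>m+1,m\<^esub> E\<^sub>m\<^sup>T\<close>. The extended matrix of system \<open>i\<close> is \<open>S\<^sub>i\<close>
  with the block row \<open>-\<tau>\<^sub>i L\<close> appended, and the FOM coefficient solves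
  \<open>S\<^sub>i Z\<^sub>F\<^sub>O\<^sub>M = E\<^sub>1 R\<^sub>i\<close>. Both GMRES conditions turn out to be a perturbation of this equation,
  \<open>(I + U G) Z\<^sub>G\<^sub>M\<^sub>R\<^sub>E\<^sub>S = Z\<^sub>F\<^sub>O\<^sub>M\<close>,
  in which \<open>U\<close> has only \<open>p\<close> columns and \<open>G\<close> only \<open>p\<close> rows. The Woodbury identity
  (\<open>woodbury_solution\<close>) inverts \<open>I + U G\<close> as \<open>I - U (I + G U)\<^sup>-\<^sup>1 G\<close>, and the subtracted term is
  \<open>\<Omega>\<^sub>i\<close>; the small matrix \<open>I + G U\<close> is nonsingular as soon as \<open>I + U G\<close> has trivial kernel.

  For the seed system (\<open>seed_solution\<close>) the equation is the normal equation of the least squares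
  problem: with \<open>T\<close> the extended matrix, \<open>T\<^sup>H T = S\<^sup>H S + |\<tau>|\<^sup>2 L\<^sup>H L = S\<^sup>H S (I + U G)\<close> for
  \<open>U = S\<^sup>-\<^sup>1 \<Gamma>\<^sub>1\<close> and \<open>G = \<Gamma>\<^sub>2\<^sup>T\<close>. As \<open>S\<close> is nonsingular, \<open>T\<close> is injective; this gives
  both the trivial kernel and, through Pythagoras in the Frobenius norm, uniqueness of the minimizer.

  For an additional system (\<open>collinear_solution\<close>) the residuals of the large problem are images of
  the projected ones under the matrix of Arnoldi vectors (\<open>residual_arnoldi\<close>), whose orthonormal
  columns allow cancelling it. The bottom block row of the collinearity condition determines the
  factor, \<open>W = \<tau> \<Psi>\<^sub>3\<^sup>T Z\<close>, and substituting it into the top block row gives the equation with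
  \<open>U = \<tau> S\<^sup>-\<^sup>1 \<Psi>\<^sub>1\<close> and \<open>G = \<Psi>\<^sub>3\<^sup>T\<close>. A kernel vector of \<open>I + U G\<close> would extend to one of
  the augmented matrix, which is nonsingular.\<close>

section \<open>Invertible matrices and the Woodbury identity\<close>

lemma minv:
  fixes S :: "'a::field mat"
  assumes S: "S \<in> carrier_mat n n" and inv: "invertible_mat S"
  shows minv_carrier: "minv S \<in> carrier_mat n n"
    and minv_mult: "minv S * S = 1\<^sub>m n"
    and mult_minv: "S * minv S = 1\<^sub>m n"
proof -
  obtain S' where "inverts_mat S S'" "inverts_mat S' S"
    using inv unfolding invertible_mat_def by blast
  hence eq: "S * S' = 1\<^sub>m n" "S' * S = 1\<^sub>m (dim_row S')"
    using S by (auto simp: inverts_mat_def)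
  have "dim_col (S * S') = n" "dim_col (S' * S) = dim_row S'"
    by (simp_all only: eq index_one_mat)
  hence S': "S' \<in> carrier_mat n n" using S by (intro carrier_matI) auto
  have "S \<in> Units (ring_mat TYPE('a) n ())"
    using S S' eq unfolding Units_def by (auto simp: ring_mat_simps)
  then obtain X where X: "mat_inverse S = Some X"
    using mat_inverse(1)[OF S] by fastforce
  from mat_inverse(2)[OF S X] X
  show "minv S \<in> carrier_mat n n" "minv S * S = 1\<^sub>m n" "S * minv S = 1\<^sub>m n"
    by (auto simp: minv_def)
qed

lemma invertible_matI_inverse:
  assumes "A \<in> carrier_mat n n" "B \<in> carrier_mat n n" "A * B = 1\<^sub>m n" "B * A = 1\<^sub>m n"
  shows "invertible_mat A"
proof -
  have "inverts_mat A B" "inverts_mat B A" using assms by (simp_all add: inverts_mat_def)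
  thus ?thesis using assms(1) unfolding invertible_mat_def by (intro conjI exI[of _ B]) auto
qed

lemma minv_mult_cancel:
  fixes S :: "'a::field mat"
  assumes S: "S \<in> carrier_mat n n" "invertible_mat S" and X: "X \<in> carrier_mat n k"
  shows "minv S * (S * X) = X" "S * (minv S * X) = X"
  unfolding assoc_mult_mat[OF minv_carrier[OF S] S(1) X, symmetric]
    assoc_mult_mat[OF S(1) minv_carrier[OF S] X, symmetric] minv_mult[OF S] mult_minv[OF S]
  using X by simp_all

lemma invertible_mult_eq_0:
  fixes S :: "'a::field mat"
  assumes S: "S \<in> carrier_mat n n" "invertible_mat S" and X: "X \<in> carrier_mat n k"
    and 0: "S * X = 0\<^sub>m n k"
  shows "X = 0\<^sub>m n k"
  using minv_mult_cancel(1)[OF S X] 0 minv_carrier[OF S] by simp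

lemma invertible_mat_trivial_kernel:
  fixes S :: "'a::field mat"
  assumes S: "S \<in> carrier_mat n n"
    and ker: "\<And>X. X \<in> carrier_mat n 1 \<Longrightarrow> S * X = 0\<^sub>m n 1 \<Longrightarrow> X = 0\<^sub>m n 1"
  shows "invertible_mat S"
proof -
  have "det S \<noteq> 0"
  proof
    assume "det S = 0"
    then obtain v where v: "v \<in> carrier_vec n" "v \<noteq> 0\<^sub>v n" "S *\<^sub>v v = 0\<^sub>v n"
      using det_0_iff_vec_prod_zero_field[OF S] by blast
    let ?X = "mat_of_cols n [v]"
    have "S * ?X = 0\<^sub>m n 1"
    proof (rule eq_matI)
      fix i j assume "i < dim_row (0\<^sub>m n 1 :: 'a mat)" "j < dim_col (0\<^sub>m n 1 :: 'a mat)"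
      hence ij: "i < n" "j = 0" by auto
      hence "(S * ?X) $$ (i, j) = (S *\<^sub>v v) $ i" using S v(1) by auto
      thus "(S * ?X) $$ (i, j) = 0\<^sub>m n 1 $$ (i, j)" using ij v(3) by auto
    qed (use S in auto)
    moreover have "?X \<in> carrier_mat n 1" by (intro carrier_matI) auto
    ultimately have "?X = 0\<^sub>m n 1" by (rule ker[rotated])
    hence "col ?X 0 = col (0\<^sub>m n 1) 0" by simp
    hence "v = 0\<^sub>v n" using v(1) by simp
    with v(2) show False by blast
  qed
  then obtain X where "X \<in> carrier_mat n n" "S * X = 1\<^sub>m n" "X * S = 1\<^sub>m n"
    using det_non_zero_imp_unit[OF S, of "()"] by (auto simp: Units_def ring_mat_simps)
  thus ?thesis using invertible_matI_inverse[OF S] by blast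
qed

text \<open>If \<open>(I + G U) Y = 0\<close> then \<open>(I + U G) U Y = U (I + G U) Y = 0\<close>, so \<open>U Y = 0\<close> and
  hence \<open>Y = - G U Y = 0\<close>.\<close>

lemma invertible_mat_one_plus_swap:
  fixes U G :: "'a::field mat"
  assumes U: "U \<in> carrier_mat n p" and G: "G \<in> carrier_mat p n"
    and ker: "\<And>X. X \<in> carrier_mat n 1 \<Longrightarrow> X + U * (G * X) = 0\<^sub>m n 1 \<Longrightarrow> X = 0\<^sub>m n 1"
  shows "invertible_mat (1\<^sub>m p + G * U)"
proof (rule invertible_mat_trivial_kernel)
  show "1\<^sub>m p + G * U \<in> carrier_mat p p" using U G by simp
  fix Y :: "'a mat" assume Y: "Y \<in> carrier_mat p 1" and "(1\<^sub>m p + G * U) * Y = 0\<^sub>m p 1"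
  hence Y0: "Y + G * (U * Y) = 0\<^sub>m p 1"
    using U G add_mult_distrib_mat[OF one_carrier_mat mult_carrier_mat[OF G U] Y]
      assoc_mult_mat[OF G U Y] by simp
  have "U * Y + U * (G * (U * Y)) = U * (Y + G * (U * Y))"
    using U G Y by (simp add: mult_add_distrib_mat[where nr = n and n = p and nc = 1])
  also have "\<dots> = 0\<^sub>m n 1" using U by (simp add: Y0)
  finally have "U * Y = 0\<^sub>m n 1" by (rule ker[OF mult_carrier_mat[OF U Y]])
  thus "Y = 0\<^sub>m p 1" using Y0 G Y by simp
qed

text \<open>Applying \<open>G\<close> to the hypothesis gives \<open>G Y = (I + G U) G X\<close>, so \<open>G X\<close>, and with it
  \<open>X = Y - U G X\<close>, can be recovered from \<open>Y\<close> by inverting only the small matrix.\<close>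

lemma woodbury_solution:
  fixes U G :: "'a::field mat"
  assumes U: "U \<in> carrier_mat n p" and G: "G \<in> carrier_mat p n"
    and inv: "invertible_mat (1\<^sub>m p + G * U)"
    and X: "X \<in> carrier_mat n k" and Y: "X + U * (G * X) = Y"
  shows "X = (1\<^sub>m n - U * minv (1\<^sub>m p + G * U) * G) * Y"
proof -
  let ?C = "1\<^sub>m p + G * U"
  have C: "?C \<in> carrier_mat p p" using U G by simp
  note Ci = minv_carrier[OF C inv]
  have GX: "G * X \<in> carrier_mat p k" using G X by simp
  have GY: "G * Y = ?C * (G * X)"
    using U G X unfolding Y[symmetric]
      mult_add_distrib_mat[OF G X mult_carrier_mat[OF U GX]]
      add_mult_distrib_mat[OF one_carrier_mat mult_carrier_mat[OF G U] GX]
      assoc_mult_mat[OF G U GX] by simp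
  have Yc: "Y \<in> carrier_mat n k" using U G X unfolding Y[symmetric] by simp
  have "(1\<^sub>m n - U * minv ?C * G) * Y = 1\<^sub>m n * Y - U * minv ?C * G * Y"
    using U G Yc Ci by (intro minus_mult_distrib_mat) auto
  also have "\<dots> = Y - U * (minv ?C * (G * Y))"
    using U G Yc Ci by (simp add: assoc_mult_mat[where ?n\<^sub>1.0 = n and ?n\<^sub>2.0 = p and ?n\<^sub>3.0 = n and ?n\<^sub>4.0 = k]
      assoc_mult_mat[where ?n\<^sub>1.0 = n and ?n\<^sub>2.0 = p and ?n\<^sub>3.0 = p]
      assoc_mult_mat[where ?n\<^sub>1.0 = p and ?n\<^sub>2.0 = p and ?n\<^sub>3.0 = n and ?n\<^sub>4.0 = k])
  also have "\<dots> = Y - U * (G * X)"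
    by (simp only: GY minv_mult_cancel(1)[OF C inv GX])
  also have "\<dots> = X" using U G X unfolding Y[symmetric] by (intro eq_matI) auto
  finally show ?thesis by simp
qed

section \<open>Conjugate transpose and Frobenius norm\<close>

lemma mat_adjoint_carrier [simp]:
  "A \<in> carrier_mat n k \<Longrightarrow> mat_adjoint A \<in> carrier_mat k n"
  by (auto simp: mat_adjoint_def)

lemma mat_adjoint_index [simp]:
  "i < dim_col A \<Longrightarrow> j < dim_row A \<Longrightarrow> mat_adjoint A $$ (i, j) = conjugate (A $$ (j, i))"
  by (simp add: mat_adjoint_def mat_of_rows_index)

lemma mat_adjoint_dim [simp]:
  "dim_row (mat_adjoint A) = dim_col A" "dim_col (mat_adjoint A) = dim_row A"
  by (auto simp: mat_adjoint_def)

lemma mat_adjoint_mult: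
  fixes A B :: "complex mat"
  assumes A: "A \<in> carrier_mat n k" and B: "B \<in> carrier_mat k l"
  shows "mat_adjoint (A * B) = mat_adjoint B * mat_adjoint A"
proof (rule eq_matI)
  fix i j assume "i < dim_row (mat_adjoint B * mat_adjoint A)" "j < dim_col (mat_adjoint B * mat_adjoint A)"
  hence ij: "i < l" "j < n" using A B by auto
  have "mat_adjoint (A * B) $$ (i, j) = cnj (\<Sum>c<k. A $$ (j, c) * B $$ (c, i))"
    using ij A B by (simp add: scalar_prod_def atLeast0LessThan)
  also have "\<dots> = (\<Sum>c<k. cnj (B $$ (c, i)) * cnj (A $$ (j, c)))"
    unfolding cnj_sum complex_cnj_mult by (rule sum.cong[OF refl mult.commute])
  also have "\<dots> = (mat_adjoint B * mat_adjoint A) $$ (i, j)"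
    using ij A B by (simp add: scalar_prod_def atLeast0LessThan)
  finally show "mat_adjoint (A * B) $$ (i, j) = (mat_adjoint B * mat_adjoint A) $$ (i, j)" .
qed (use A B in auto)

lemma mat_adjoint_one: "mat_adjoint (1\<^sub>m n) = (1\<^sub>m n :: complex mat)"
  by (intro eq_matI) auto

lemma mat_adjoint_cmat: "mat_adjoint (cmat M) = cmat M\<^sup>T"
  by (intro eq_matI) auto

lemma mat_adjoint_smult:
  "mat_adjoint (a \<cdot>\<^sub>m M) = cnj a \<cdot>\<^sub>m mat_adjoint M" for M :: "complex mat"
  by (intro eq_matI) auto

lemma invertible_mat_adjoint:
  fixes S :: "complex mat"
  assumes S: "S \<in> carrier_mat n n" "invertible_mat S"
  shows "invertible_mat (mat_adjoint S)"
proof (rule invertible_matI_inverse)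
  note i = minv[OF S]
  show "mat_adjoint S \<in> carrier_mat n n" "mat_adjoint (minv S) \<in> carrier_mat n n"
    using S i by auto
  show "mat_adjoint S * mat_adjoint (minv S) = 1\<^sub>m n" "mat_adjoint (minv S) * mat_adjoint S = 1\<^sub>m n"
    unfolding mat_adjoint_mult[OF i(1) S(1), symmetric] mat_adjoint_mult[OF S(1) i(1), symmetric]
    using i(2,3) by (simp_all add: mat_adjoint_one)
qed

lemma frob_norm_nonneg: "frob_norm A \<ge> 0"
  by (simp add: frob_norm_def sum_nonneg)

lemma frob_norm_sq: "(frob_norm A)\<^sup>2 = (\<Sum>i<dim_row A. \<Sum>j<dim_col A. (cmod (A $$ (i, j)))\<^sup>2)"
  by (simp add: frob_norm_def sum_nonneg)

lemma frob_norm_eq_0D: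
  assumes "A \<in> carrier_mat n k" "frob_norm A = 0"
  shows "A = 0\<^sub>m n k"
proof (rule eq_matI)
  fix i j assume "i < dim_row (0\<^sub>m n k :: complex mat)" "j < dim_col (0\<^sub>m n k :: complex mat)"
  hence ij: "i < n" "j < k" by auto
  have "(\<Sum>i<n. \<Sum>j<k. (cmod (A $$ (i, j)))\<^sup>2) = 0"
    using assms frob_norm_sq[of A] by auto
  hence "(\<Sum>j<k. (cmod (A $$ (i, j)))\<^sup>2) = 0"
    using ij by (subst (asm) sum_nonneg_eq_0_iff) (auto intro!: sum_nonneg)
  thus "A $$ (i, j) = 0\<^sub>m n k $$ (i, j)"
    using ij by (subst (asm) sum_nonneg_eq_0_iff) auto
qed (use assms in auto)

text \<open>The diagonal entries of \<open>D\<^sup>H r\<close> are the inner products of corresponding columns of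
  \<open>D\<close> and \<open>r\<close>, and the mixed term of the squared norm is twice the real part of their sum.\<close>

lemma frob_norm_pythagoras:
  assumes r: "r \<in> carrier_mat n k" and D: "D \<in> carrier_mat n k"
    and orth: "mat_adjoint D * r = 0\<^sub>m k k"
  shows "(frob_norm (r + D))\<^sup>2 = (frob_norm r)\<^sup>2 + (frob_norm D)\<^sup>2"
proof -
  have col0: "(\<Sum>i<n. cnj (D $$ (i, j)) * r $$ (i, j)) = 0" if "j < k" for j
  proof -
    have "(mat_adjoint D * r) $$ (j, j) = (\<Sum>i<n. cnj (D $$ (i, j)) * r $$ (i, j))"
      using r D that by (simp add: scalar_prod_def atLeast0LessThan)
    thus ?thesis using that by (simp add: orth)
  qed
  have entry: "(cmod (x + y))\<^sup>2 = (cmod x)\<^sup>2 + (cmod y)\<^sup>2 + 2 * Re (cnj y * x)" for x y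
    unfolding cmod_power2 by (simp add: power2_eq_square algebra_simps)
  have "(\<Sum>i<n. \<Sum>j<k. Re (cnj (D $$ (i, j)) * r $$ (i, j)))
      = (\<Sum>j<k. Re (\<Sum>i<n. cnj (D $$ (i, j)) * r $$ (i, j)))"
    by (subst sum.swap) simp
  also have "\<dots> = 0" using col0 by simp
  finally have cross: "(\<Sum>i<n. \<Sum>j<k. 2 * Re (cnj (D $$ (i, j)) * r $$ (i, j))) = 0"
    by (simp flip: sum_distrib_left)
  have "(frob_norm (r + D))\<^sup>2 = (\<Sum>i<n. \<Sum>j<k. (cmod (r $$ (i, j) + D $$ (i, j)))\<^sup>2)"
    using r D by (simp add: frob_norm_sq)
  also have "\<dots> = (frob_norm r)\<^sup>2 + (frob_norm D)\<^sup>2"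
    using r D by (simp only: entry sum.distrib cross frob_norm_sq carrier_matD add_0_right)
  finally show ?thesis .
qed

text \<open>\<open>T X\<close> is then orthogonal to itself: Pythagoras is applied to \<open>0 = - T X + T X\<close>.\<close>

lemma adjoint_mult_self_eq_0:
  fixes T X :: "complex mat"
  assumes T: "T \<in> carrier_mat n l" and X: "X \<in> carrier_mat l k"
    and eq: "mat_adjoint T * (T * X) = 0\<^sub>m l k"
  shows "T * X = 0\<^sub>m n k"
proof -
  have TX: "T * X \<in> carrier_mat n k" using T X by simp
  have "mat_adjoint (T * X) * - (T * X) = - (mat_adjoint X * (mat_adjoint T * (T * X)))"
    using T X assoc_mult_mat[OF mat_adjoint_carrier[OF X] mat_adjoint_carrier[OF T] TX]
    by (simp add: mat_adjoint_mult[OF T X])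
  also have "\<dots> = 0\<^sub>m k k" unfolding eq using X by (intro eq_matI) auto
  finally have "(frob_norm (- (T * X) + T * X))\<^sup>2 = (frob_norm (- (T * X)))\<^sup>2 + (frob_norm (T * X))\<^sup>2"
    using TX by (intro frob_norm_pythagoras) auto
  moreover have "- (T * X) + T * X = 0\<^sub>m n k" using TX by (intro eq_matI) auto
  moreover have "(frob_norm (0\<^sub>m n k))\<^sup>2 = 0" by (simp add: frob_norm_sq)
  ultimately have "(frob_norm (- (T * X)))\<^sup>2 + (frob_norm (T * X))\<^sup>2 = 0" by simp
  hence "frob_norm (T * X) = 0" by (simp add: sum_power2_eq_zero_iff)
  thus ?thesis using frob_norm_eq_0D[OF TX] by blast
qed

text \<open>A solution \<open>Z0\<close> of the normal equation has a residual orthogonal to the range of \<open>T\<close>.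
  So the squared norm at any other \<open>Z\<close> exceeds the one at \<open>Z0\<close> by the squared norm of
  \<open>T (Z0 - Z)\<close>, which must vanish at a minimizer.\<close>

lemma least_squares_minimizer:
  assumes T: "T \<in> carrier_mat n l" and b: "b \<in> carrier_mat n k"
    and Z0: "Z0 \<in> carrier_mat l k" and normal: "mat_adjoint T * (T * Z0) = mat_adjoint T * b"
    and min: "is_arg_min (\<lambda>X. frob_norm (b - T * X)) (\<lambda>X. X \<in> carrier_mat l k) Z"
  shows "T * Z = T * Z0"
proof -
  have Z: "Z \<in> carrier_mat l k" and le: "frob_norm (b - T * Z) \<le> frob_norm (b - T * Z0)"
    using min Z0 unfolding is_arg_min_def by (auto simp: not_less)
  define D where "D = T * (Z0 - Z)"
  have D: "D \<in> carrier_mat n k" and TZ: "T * Z \<in> carrier_mat n k" "T * Z0 \<in> carrier_mat n k"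
    using T Z Z0 by (auto simp: D_def)
  have "mat_adjoint T * (b - T * Z0) = 0\<^sub>m l k"
    unfolding mult_minus_distrib_mat[OF mat_adjoint_carrier[OF T] b TZ(2)] normal
    using mult_carrier_mat[OF mat_adjoint_carrier[OF T] b] by (intro minus_r_inv_mat)
  moreover have "mat_adjoint D * (b - T * Z0) = mat_adjoint (Z0 - Z) * (mat_adjoint T * (b - T * Z0))"
    unfolding D_def mat_adjoint_mult[OF T minus_carrier_mat[OF Z]]
    by (rule assoc_mult_mat[OF mat_adjoint_carrier[OF minus_carrier_mat[OF Z]]
          mat_adjoint_carrier[OF T] minus_carrier_mat[OF TZ(2)]])
  ultimately have "mat_adjoint D * (b - T * Z0) = 0\<^sub>m k k" using Z Z0
    by (simp add: right_mult_zero_mat[of _ k l])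
  hence "(frob_norm ((b - T * Z0) + D))\<^sup>2 = (frob_norm (b - T * Z0))\<^sup>2 + (frob_norm D)\<^sup>2"
    by (intro frob_norm_pythagoras[OF minus_carrier_mat[OF TZ(2)] D])
  moreover have D': "D = T * Z0 - T * Z"
    using T Z Z0 by (simp add: D_def mult_minus_distrib_mat)
  moreover have "(b - T * Z0) + D = b - T * Z"
    unfolding D' using b carrier_matD[OF TZ(1)] carrier_matD[OF TZ(2)]
    by (intro eq_matI) (auto simp del: index_mult_mat)
  ultimately have "(frob_norm D)\<^sup>2 \<le> 0"
    using power_mono[OF le frob_norm_nonneg, of 2] by simp
  hence "D = 0\<^sub>m n k" using frob_norm_eq_0D[OF D] by simp
  hence 0: "(T * Z0 - T * Z) $$ (i, j) = 0" if "i < n" "j < k" for i j using D' that by simp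
  show ?thesis
  proof (rule eq_matI)
    fix i j assume "i < dim_row (T * Z0)" "j < dim_col (T * Z0)"
    thus "(T * Z) $$ (i, j) = (T * Z0) $$ (i, j)" using 0[of i j] T Z Z0 by auto
  qed (use T Z Z0 in auto)
qed

section \<open>Matrices split into two block rows\<close>

lemma index_append_rows:
  assumes "A \<in> carrier_mat n k" "B \<in> carrier_mat q k" "i < n + q" "j < k"
  shows "(A @\<^sub>r B) $$ (i, j) = (if i < n then A $$ (i, j) else B $$ (i - n, j))"
  using assms by (auto simp: append_rows_def)

lemma append_rows_eq_iff:
  assumes "A \<in> carrier_mat n k" "B \<in> carrier_mat q k" "C \<in> carrier_mat n k" "D \<in> carrier_mat q k"
  shows "A @\<^sub>r B = C @\<^sub>r D \<longleftrightarrow> A = C \<and> B = D"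
proof
  assume eq: "A @\<^sub>r B = C @\<^sub>r D"
  show "A = C \<and> B = D"
  proof (intro conjI eq_matI)
    fix i j assume "i < dim_row C" "j < dim_col C"
    thus "A $$ (i, j) = C $$ (i, j)"
      using arg_cong[OF eq, of "\<lambda>M. M $$ (i, j)"] assms by (simp add: index_append_rows)
  next
    fix i j assume "i < dim_row D" "j < dim_col D"
    thus "B $$ (i, j) = D $$ (i, j)"
      using arg_cong[OF eq, of "\<lambda>M. M $$ (i + n, j)"] assms by (simp add: index_append_rows)
  qed (use assms in auto)
qed simp

lemma append_rows_add:
  assumes "A \<in> carrier_mat n k" "B \<in> carrier_mat q k" "C \<in> carrier_mat n k" "D \<in> carrier_mat q k"
  shows "(A @\<^sub>r B) + (C @\<^sub>r D) = (A + C) @\<^sub>r (B + D)"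
  using assms by (intro eq_matI) (auto simp: append_rows_def)

lemma append_rows_minus:
  fixes A :: "'a::group_add mat"
  assumes "A \<in> carrier_mat n k" "B \<in> carrier_mat q k" "C \<in> carrier_mat n k" "D \<in> carrier_mat q k"
  shows "(A @\<^sub>r B) - (C @\<^sub>r D) = (A - C) @\<^sub>r (B - D)"
  using assms by (intro eq_matI) (auto simp: append_rows_def)

lemma append_rows_mult:
  fixes A :: "'a::semiring_0 mat"
  assumes "A \<in> carrier_mat n l" "B \<in> carrier_mat q l" "X \<in> carrier_mat l k"
  shows "(A @\<^sub>r B) * X = (A * X) @\<^sub>r (B * X)"
proof -
  let ?A = "A @\<^sub>r B"
  have dim: "?A \<in> carrier_mat (n + q) l" using carrier_append_rows assms by blast
  have row: "row ?A i = (if i < n then row A i else row B (i - n))" if "i < n + q" for i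
    using assms that carrier_matD[OF dim] by (intro eq_vecI) (auto simp: index_append_rows)
  have AX: "A * X \<in> carrier_mat n k" "B * X \<in> carrier_mat q k" using assms by auto
  have AXX: "(A * X) @\<^sub>r (B * X) \<in> carrier_mat (n + q) k" using carrier_append_rows AX by blast
  show ?thesis
  proof (rule eq_matI)
    fix i j assume "i < dim_row ((A * X) @\<^sub>r (B * X))" "j < dim_col ((A * X) @\<^sub>r (B * X))"
    hence ij: "i < n + q" "j < k" using AXX by auto
    show "(?A * X) $$ (i, j) = ((A * X) @\<^sub>r (B * X)) $$ (i, j)"
      unfolding index_append_rows[OF AX ij] using ij assms carrier_matD[OF dim] by (simp add: row)
  qed (use carrier_matD[OF AXX] carrier_matD[OF dim] assms in auto)
qed

lemma four_block_mat_empty: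
  assumes "M \<in> carrier_mat n k" "X \<in> carrier_mat n 0" "Y \<in> carrier_mat 0 k" "W \<in> carrier_mat 0 0"
  shows "four_block_mat M X Y W = M"
  using assms by (intro eq_matI) auto

lemma mat_adjoint_append_rows_mult:
  fixes A :: "complex mat"
  assumes A: "A \<in> carrier_mat n l" and B: "B \<in> carrier_mat q l"
    and C: "C \<in> carrier_mat n k" and D: "D \<in> carrier_mat q k"
  shows "mat_adjoint (A @\<^sub>r B) * (C @\<^sub>r D) = mat_adjoint A * C + mat_adjoint B * D"
proof -
  have AB: "mat_adjoint (A @\<^sub>r B) = four_block_mat (mat_adjoint A) (mat_adjoint B) (0\<^sub>m 0 n) (0\<^sub>m 0 q)"
    using A B by (intro eq_matI) (auto simp: append_rows_def)
  have CD: "C @\<^sub>r D = four_block_mat C (0\<^sub>m n 0) D (0\<^sub>m q 0)"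
    using C D by (simp add: append_rows_def)
  have M: "mat_adjoint A * C + mat_adjoint B * D \<in> carrier_mat l k"
    by (intro add_carrier_mat mult_carrier_mat[OF mat_adjoint_carrier[OF B] D])
  show ?thesis
    unfolding AB CD mult_four_block_mat[OF mat_adjoint_carrier[OF A] mat_adjoint_carrier[OF B]
      zero_carrier_mat zero_carrier_mat C zero_carrier_mat D zero_carrier_mat]
    by (rule four_block_mat_empty[OF M]) (use A B C D in auto)
qed

lemma append_cols_mult:
  fixes A :: "'a::semiring_0 mat"
  assumes A: "A \<in> carrier_mat n k" and B: "B \<in> carrier_mat n l"
    and X: "X \<in> carrier_mat k q" and Y: "Y \<in> carrier_mat l q"
  shows "(A @\<^sub>c B) * (X @\<^sub>r Y) = A * X + B * Y"
proof -
  have XY: "X @\<^sub>r Y = four_block_mat X (0\<^sub>m k 0) Y (0\<^sub>m l 0)"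
    using X Y by (simp add: append_rows_def)
  have AB: "A @\<^sub>c B = four_block_mat A B (0\<^sub>m 0 k) (0\<^sub>m 0 l)"
    using A B by (simp add: append_cols_def)
  have M: "A * X + B * Y \<in> carrier_mat n q"
    by (intro add_carrier_mat mult_carrier_mat[OF B Y])
  show ?thesis
    unfolding AB XY mult_four_block_mat[OF A B zero_carrier_mat zero_carrier_mat
      X zero_carrier_mat Y zero_carrier_mat]
    by (rule four_block_mat_empty[OF M]) (use A B X Y in auto)
qed


section \<open>The two projected problems\<close>

text \<open>The hypothesis \<open>S\<^sup>H \<Gamma> G = K\<^sup>H K\<close> lets the Gram matrix \<open>S\<^sup>H S + K\<^sup>H K\<close> of the extended
  matrix be written as \<open>S\<^sup>H S (I + U G)\<close>. The right-hand side of the normal equation is \<open>S\<^sup>H b\<close>,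
  because the appended rows of the data are zero, so \<open>S\<^sup>H S\<close> cancels to \<open>(I + U G) Z = S\<^sup>-\<^sup>1 b\<close>.\<close>

lemma seed_solution:
  fixes S K \<Gamma> G b Z :: "complex mat"
  assumes S: "S \<in> carrier_mat n n" "invertible_mat S" and K: "K \<in> carrier_mat q n"
    and \<Gamma>: "\<Gamma> \<in> carrier_mat n p" and G: "G \<in> carrier_mat p n"
    and factor: "mat_adjoint S * (\<Gamma> * G) = mat_adjoint K * K"
    and b: "b \<in> carrier_mat n k"
    and min: "is_arg_min (\<lambda>X. frob_norm ((b @\<^sub>r 0\<^sub>m q k) - (S @\<^sub>r K) * X)) (\<lambda>X. X \<in> carrier_mat n k) Z"
  defines "U \<equiv> minv S * \<Gamma>"
  shows "invertible_mat (1\<^sub>m p + G * U)"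
    and "Z = (1\<^sub>m n - U * minv (1\<^sub>m p + G * U) * G) * (minv S * b)"
proof -
  let ?T = "S @\<^sub>r K"
  note Si = minv_carrier[OF S]
  have Sa: "mat_adjoint S \<in> carrier_mat n n" and Ka: "mat_adjoint K \<in> carrier_mat n q"
    using S K by auto
  have T: "?T \<in> carrier_mat (n + q) n" using carrier_append_rows[OF S(1) K] .
  have U: "U \<in> carrier_mat n p" unfolding U_def using mult_carrier_mat[OF Si \<Gamma>] .
  have normal_op: "mat_adjoint ?T * (?T * X) = mat_adjoint S * (S * (X + U * (G * X)))"
    if X: "X \<in> carrier_mat n l" for X l
  proof -
    have GX: "G * X \<in> carrier_mat p l" using mult_carrier_mat[OF G X] .
    have SX: "S * X \<in> carrier_mat n l" and KX: "K * X \<in> carrier_mat q l"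
      and \<Gamma>GX: "\<Gamma> * (G * X) \<in> carrier_mat n l"
      using mult_carrier_mat[OF S(1) X] mult_carrier_mat[OF K X] mult_carrier_mat[OF \<Gamma> GX] .
    have "mat_adjoint K * (K * X) = mat_adjoint S * (\<Gamma> * G) * X"
      unfolding factor by (rule assoc_mult_mat[OF Ka K X, symmetric])
    also have "\<dots> = mat_adjoint S * (\<Gamma> * (G * X))"
      unfolding assoc_mult_mat[OF Sa mult_carrier_mat[OF \<Gamma> G] X] assoc_mult_mat[OF \<Gamma> G X] ..
    finally have KK: "mat_adjoint K * (K * X) = mat_adjoint S * (\<Gamma> * (G * X))" .
    have "S * (U * (G * X)) = \<Gamma> * (G * X)"
      unfolding U_def assoc_mult_mat[OF Si \<Gamma> GX] by (rule minv_mult_cancel(2)[OF S \<Gamma>GX])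
    hence SXU: "S * (X + U * (G * X)) = S * X + \<Gamma> * (G * X)"
      unfolding mult_add_distrib_mat[OF S(1) X mult_carrier_mat[OF U GX]] by simp
    show ?thesis
      unfolding append_rows_mult[OF S(1) K X] mat_adjoint_append_rows_mult[OF S(1) K SX KX]
        KK SXU mult_add_distrib_mat[OF Sa SX \<Gamma>GX] ..
  qed
  \<comment> \<open>The top block row \<open>S\<close> alone makes the extended matrix injective.\<close>
  have T_inj: "X = 0\<^sub>m n l" if X: "X \<in> carrier_mat n l" and TX: "?T * X = 0\<^sub>m (n + q) l" for X l
  proof -
    have "(S * X) @\<^sub>r (K * X) = 0\<^sub>m n l @\<^sub>r 0\<^sub>m q l"
      unfolding append_rows_mult[OF S(1) K X, symmetric] TX
      by (intro eq_matI) (auto simp: append_rows_def)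
    hence "S * X = 0\<^sub>m n l"
      using append_rows_eq_iff[OF mult_carrier_mat[OF S(1) X] mult_carrier_mat[OF K X]
          zero_carrier_mat zero_carrier_mat] by blast
    thus ?thesis by (rule invertible_mult_eq_0[OF S X])
  qed
  have ker: "X = 0\<^sub>m n 1" if X: "X \<in> carrier_mat n 1" and 0: "X + U * (G * X) = 0\<^sub>m n 1" for X
  proof -
    have "mat_adjoint ?T * (?T * X) = 0\<^sub>m n 1"
      unfolding normal_op[OF X] 0 right_mult_zero_mat[OF S(1)] by (rule right_mult_zero_mat[OF Sa])
    from T_inj[OF X adjoint_mult_self_eq_0[OF T X this]] show ?thesis .
  qed
  show inv: "invertible_mat (1\<^sub>m p + G * U)"
    using invertible_mat_one_plus_swap[OF U G ker] .
  have UG: "U * G \<in> carrier_mat n n" using mult_carrier_mat[OF U G] .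
  have split: "(1\<^sub>m n + U * G) * X = X + U * (G * X)" if X: "X \<in> carrier_mat n l" for X l
    unfolding add_mult_distrib_mat[OF one_carrier_mat UG X] assoc_mult_mat[OF U G X]
    using X by simp
  have C: "1\<^sub>m n + U * G \<in> carrier_mat n n" using UG by simp
  have invC: "invertible_mat (1\<^sub>m n + U * G)"
    using invertible_mat_trivial_kernel[OF C] ker split by metis
  have Sb: "minv S * b \<in> carrier_mat n k" using mult_carrier_mat[OF Si b] .
  \<comment> \<open>The claimed formula need not be checked directly: \<open>Z0\<close> solves the normal equation by
    construction, and the formula for it follows from the Woodbury identity.\<close>
  define Z0 where "Z0 = minv (1\<^sub>m n + U * G) * (minv S * b)"
  have Z0: "Z0 \<in> carrier_mat n k"
    unfolding Z0_def using mult_carrier_mat[OF minv_carrier[OF C invC] Sb] .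
  have eq: "Z0 + U * (G * Z0) = minv S * b"
    unfolding split[OF Z0, symmetric] unfolding Z0_def by (rule minv_mult_cancel(2)[OF C invC Sb])
  have bq: "b @\<^sub>r 0\<^sub>m q k \<in> carrier_mat (n + q) k" using carrier_append_rows[OF b zero_carrier_mat] .
  have "mat_adjoint ?T * (b @\<^sub>r 0\<^sub>m q k) = mat_adjoint S * b"
    unfolding mat_adjoint_append_rows_mult[OF S(1) K b zero_carrier_mat] right_mult_zero_mat[OF Ka]
    by (rule right_add_zero_mat[OF mult_carrier_mat[OF Sa b]])
  hence "mat_adjoint ?T * (?T * Z0) = mat_adjoint ?T * (b @\<^sub>r 0\<^sub>m q k)"
    unfolding normal_op[OF Z0] eq minv_mult_cancel(2)[OF S b] by simp
  from least_squares_minimizer[OF T bq Z0 this min] have TZ: "?T * Z = ?T * Z0" .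
  have Z: "Z \<in> carrier_mat n k" using min by (simp add: is_arg_min_def)
  have "Z - Z0 = 0\<^sub>m n k"
  proof (rule T_inj)
    show "Z - Z0 \<in> carrier_mat n k" by (rule minus_carrier_mat[OF Z0])
    show "?T * (Z - Z0) = 0\<^sub>m (n + q) k"
      unfolding mult_minus_distrib_mat[OF T Z Z0] TZ using mult_carrier_mat[OF T Z0] by simp
  qed
  hence "Z = Z0" using Z Z0 by (intro eq_matI) (auto simp: mat_eq_iff)
  thus "Z = (1\<^sub>m n - U * minv (1\<^sub>m p + G * U) * G) * (minv S * b)"
    using woodbury_solution[OF U G inv Z0 eq] by simp
qed

text \<open>The block rows of the collinearity condition read \<open>S Z + \<Psi>1 W = b\<close> and
  \<open>\<Psi>2 W = t L Z\<close>. Eliminating \<open>W = t G Z\<close> and multiplying by the inverse of \<open>S\<close> leaves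
  \<open>Z + U G Z = S\<^sup>-\<^sup>1 b\<close>.\<close>

lemma collinear_solution:
  fixes S L \<Psi>1 \<Psi>2 b Z W :: "complex mat"
  assumes S: "S \<in> carrier_mat n n" "invertible_mat S" and L: "L \<in> carrier_mat p n"
    and \<Psi>1: "\<Psi>1 \<in> carrier_mat n p" and \<Psi>2: "\<Psi>2 \<in> carrier_mat p p" "invertible_mat \<Psi>2"
    and aug: "invertible_mat ((S @\<^sub>r (- t \<cdot>\<^sub>m L)) @\<^sub>c (\<Psi>1 @\<^sub>r \<Psi>2))"
    and b: "b \<in> carrier_mat n k" and Z: "Z \<in> carrier_mat n k" and W: "W \<in> carrier_mat p k"
    and collinear: "(b @\<^sub>r 0\<^sub>m p k) - (S @\<^sub>r (- t \<cdot>\<^sub>m L)) * Z = (\<Psi>1 @\<^sub>r \<Psi>2) * W"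
  defines "U \<equiv> t \<cdot>\<^sub>m (minv S * \<Psi>1)" and "G \<equiv> minv \<Psi>2 * L"
  shows "invertible_mat (1\<^sub>m p + G * U)"
    and "Z = (1\<^sub>m n - U * minv (1\<^sub>m p + G * U) * G) * (minv S * b)"
proof -
  note Si = minv_carrier[OF S] and \<Psi>i = minv_carrier[OF \<Psi>2]
  have K: "- t \<cdot>\<^sub>m L \<in> carrier_mat p n" using L by simp
  have U: "U \<in> carrier_mat n p" unfolding U_def using mult_carrier_mat[OF Si \<Psi>1] by simp
  have G: "G \<in> carrier_mat p n" unfolding G_def using mult_carrier_mat[OF \<Psi>i L] .
  have top: "S * (X + U * (G * X)) = S * X + \<Psi>1 * (t \<cdot>\<^sub>m (G * X))"
    if X: "X \<in> carrier_mat n l" for X l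
  proof -
    have GX: "G * X \<in> carrier_mat p l" using mult_carrier_mat[OF G X] .
    have \<Psi>GX: "\<Psi>1 * (t \<cdot>\<^sub>m (G * X)) \<in> carrier_mat n l" using \<Psi>1 GX by (intro mult_carrier_mat) auto
    have "U * (G * X) = minv S * (\<Psi>1 * (t \<cdot>\<^sub>m (G * X)))"
      unfolding U_def mult_smult_assoc_mat[OF mult_carrier_mat[OF Si \<Psi>1] GX]
        assoc_mult_mat[OF Si \<Psi>1 GX] mult_smult_distrib[OF \<Psi>1 GX]
        mult_smult_distrib[OF Si mult_carrier_mat[OF \<Psi>1 GX]] ..
    thus ?thesis
      unfolding mult_add_distrib_mat[OF S(1) X mult_carrier_mat[OF U GX]]
      using minv_mult_cancel(2)[OF S \<Psi>GX] by simp
  qed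
  have bottom: "\<Psi>2 * (t \<cdot>\<^sub>m (G * X)) = t \<cdot>\<^sub>m (L * X)" if X: "X \<in> carrier_mat n l" for X l
    unfolding mult_smult_distrib[OF \<Psi>2(1) mult_carrier_mat[OF G X]]
    unfolding G_def assoc_mult_mat[OF \<Psi>i L X] minv_mult_cancel(2)[OF \<Psi>2 mult_carrier_mat[OF L X]] ..
  have cancel: "- t \<cdot>\<^sub>m M + t \<cdot>\<^sub>m M = 0\<^sub>m p l" "0\<^sub>m p l - - t \<cdot>\<^sub>m M = t \<cdot>\<^sub>m M"
    if "M \<in> carrier_mat p l" for M l
    using that by (auto intro!: eq_matI)
  have KX: "(- t \<cdot>\<^sub>m L) * X + t \<cdot>\<^sub>m (L * X) = 0\<^sub>m p l" if X: "X \<in> carrier_mat n l" for X l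
    unfolding mult_smult_assoc_mat[OF L X]
    by (rule cancel(1)[OF mult_carrier_mat[OF L X]])
  have ker: "X = 0\<^sub>m n 1" if X: "X \<in> carrier_mat n 1" and 0: "X + U * (G * X) = 0\<^sub>m n 1" for X
  proof -
    \<comment> \<open>The second block of a kernel vector of the augmented matrix, as the bottom row forces it.\<close>
    define Y where "Y = t \<cdot>\<^sub>m (G * X)"
    have Y: "Y \<in> carrier_mat p 1" unfolding Y_def using mult_carrier_mat[OF G X] by simp
    note SX = mult_carrier_mat[OF S(1) X] and KX' = mult_carrier_mat[OF K X]
      and \<Psi>1Y = mult_carrier_mat[OF \<Psi>1 Y] and \<Psi>2Y = mult_carrier_mat[OF \<Psi>2(1) Y]
    have 1: "S * X + \<Psi>1 * Y = 0\<^sub>m n 1"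
      unfolding Y_def top[OF X, symmetric] 0 by (rule right_mult_zero_mat[OF S(1)])
    have 2: "(- t \<cdot>\<^sub>m L) * X + \<Psi>2 * Y = 0\<^sub>m p 1"
      unfolding Y_def bottom[OF X] by (rule KX[OF X])
    have "((S @\<^sub>r (- t \<cdot>\<^sub>m L)) @\<^sub>c (\<Psi>1 @\<^sub>r \<Psi>2)) * (X @\<^sub>r Y) = 0\<^sub>m n 1 @\<^sub>r 0\<^sub>m p 1"
      unfolding append_cols_mult[OF carrier_append_rows[OF S(1) K] carrier_append_rows[OF \<Psi>1 \<Psi>2(1)] X Y]
        append_rows_mult[OF S(1) K X] append_rows_mult[OF \<Psi>1 \<Psi>2(1) Y]
        append_rows_add[OF SX KX' \<Psi>1Y \<Psi>2Y] 1 2 ..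
    also have zz: "0\<^sub>m n 1 @\<^sub>r 0\<^sub>m p 1 = (0\<^sub>m (n + p) 1 :: complex mat)"
      by (intro eq_matI) (auto simp: append_rows_def)
    finally have prod0: "((S @\<^sub>r (- t \<cdot>\<^sub>m L)) @\<^sub>c (\<Psi>1 @\<^sub>r \<Psi>2)) * (X @\<^sub>r Y) = 0\<^sub>m (n + p) 1" .
    have "(S @\<^sub>r (- t \<cdot>\<^sub>m L)) @\<^sub>c (\<Psi>1 @\<^sub>r \<Psi>2) \<in> carrier_mat (n + p) (n + p)"
      using carrier_append_rows[OF S(1) K] carrier_append_rows[OF \<Psi>1 \<Psi>2(1)]
      by (intro carrier_matI) (auto simp: append_cols_def)
    from invertible_mult_eq_0[OF this aug carrier_append_rows[OF X Y] prod0]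
    have "X @\<^sub>r Y = 0\<^sub>m n 1 @\<^sub>r 0\<^sub>m p 1" unfolding zz .
    thus ?thesis using append_rows_eq_iff[OF X Y zero_carrier_mat zero_carrier_mat] by blast
  qed
  show inv: "invertible_mat (1\<^sub>m p + G * U)"
    using invertible_mat_one_plus_swap[OF U G ker] .
  note SZ = mult_carrier_mat[OF S(1) Z] and KZ = mult_carrier_mat[OF K Z]
    and LZ = mult_carrier_mat[OF L Z]
    and \<Psi>1W = mult_carrier_mat[OF \<Psi>1 W] and \<Psi>2W = mult_carrier_mat[OF \<Psi>2(1) W]
  have "(b @\<^sub>r 0\<^sub>m p k) - ((S * Z) @\<^sub>r ((- t \<cdot>\<^sub>m L) * Z)) = (b - S * Z) @\<^sub>r (0\<^sub>m p k - (- t \<cdot>\<^sub>m L) * Z)"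
    by (rule append_rows_minus[OF b zero_carrier_mat SZ KZ])
  with collinear have "(b - S * Z) @\<^sub>r (0\<^sub>m p k - (- t \<cdot>\<^sub>m L) * Z) = (\<Psi>1 * W) @\<^sub>r (\<Psi>2 * W)"
    unfolding append_rows_mult[OF S(1) K Z] append_rows_mult[OF \<Psi>1 \<Psi>2(1) W] by simp
  hence 1: "b - S * Z = \<Psi>1 * W" and 2: "0\<^sub>m p k - (- t \<cdot>\<^sub>m L) * Z = \<Psi>2 * W"
    using append_rows_eq_iff[OF minus_carrier_mat[OF SZ] minus_carrier_mat[OF KZ] \<Psi>1W \<Psi>2W] by blast+
  have "0\<^sub>m p k - (- t \<cdot>\<^sub>m L) * Z = t \<cdot>\<^sub>m (L * Z)"
    unfolding mult_smult_assoc_mat[OF L Z] by (rule cancel(2)[OF LZ])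
  hence "\<Psi>2 * W = \<Psi>2 * (t \<cdot>\<^sub>m (G * Z))" using 2 bottom[OF Z] by simp
  hence "minv \<Psi>2 * (\<Psi>2 * W) = minv \<Psi>2 * (\<Psi>2 * (t \<cdot>\<^sub>m (G * Z)))" by (rule arg_cong)
  hence W_eq: "W = t \<cdot>\<^sub>m (G * Z)"
    unfolding minv_mult_cancel(1)[OF \<Psi>2 W]
      minv_mult_cancel(1)[OF \<Psi>2 smult_carrier_mat[OF mult_carrier_mat[OF G Z]]] .
  have "S * (Z + U * (G * Z)) = S * Z + (b - S * Z)"
    unfolding top[OF Z] W_eq[symmetric] 1 ..
  also have "\<dots> = b" using b carrier_matD[OF SZ] by (intro eq_matI) (auto simp del: index_mult_mat)
  finally have "S * (Z + U * (G * Z)) = b" .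
  moreover have "Z + U * (G * Z) \<in> carrier_mat n k"
    using mult_carrier_mat[OF U mult_carrier_mat[OF G Z]] by simp
  ultimately have "Z + U * (G * Z) = minv S * b" using minv_mult_cancel(1)[OF S] by metis
  thus "Z = (1\<^sub>m n - U * minv (1\<^sub>m p + G * U) * G) * (minv S * b)"
    by (rule woodbury_solution[OF U G inv Z])
qed


section \<open>Block unit matrices and the block Arnoldi relation\<close>

lemma block_unit_carrier [simp]: "block_unit m p j \<in> carrier_mat (m * p) p"
  by (simp add: block_unit_def)

text \<open>The bounds on the block number keep every column within the identity matrix, where the
  entries are 0 or 1; beyond it they would be unspecified.\<close>

lemma map_block_unit:
  assumes "1 \<le> j" "j \<le> m"
  shows "cmat (block_unit m p j) = block_unit m p j"
proof -
  have "(j - 1) * p + c < m * p" if "c < p" for c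
  proof -
    have "(j - 1) * p + c < (j - 1) * p + p" using that by simp
    also have "\<dots> = j * p" using \<open>1 \<le> j\<close> by (simp add: algebra_simps)
    also have "\<dots> \<le> m * p" using \<open>j \<le> m\<close> by simp
    finally show ?thesis .
  qed
  thus ?thesis by (intro eq_matI) (auto simp: block_unit_def)
qed

lemma block_unit_first_extend:
  assumes "1 \<le> m"
  shows "block_unit (Suc m) p 1 = block_unit m p 1 @\<^sub>r (0\<^sub>m p p :: 'a::{zero,one} mat)"
proof -
  have "p \<le> m * p" using assms by simp
  hence "j < m * p" if "j < p" for j using that by linarith
  thus ?thesis by (intro eq_matI) (auto simp: block_unit_def append_rows_def)
qed

lemma block_row_carrier:
  "\<forall>j\<in>{1..k}. V j \<in> carrier_mat n p \<Longrightarrow> block_row n V k \<in> carrier_mat n (k * p)"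
proof (induction k)
  case (Suc k)
  hence "block_row n V k \<in> carrier_mat n (k * p)" "V (Suc k) \<in> carrier_mat n p" by auto
  thus ?case by (intro carrier_matI) (auto simp: append_cols_def)
qed simp

lemma index_block_row_first:
  assumes "\<forall>j\<in>{1..Suc k}. V j \<in> carrier_mat n p" "r < n" "c < p"
  shows "block_row n V (Suc k) $$ (r, c) = V 1 $$ (r, c)"
  using assms
proof (induction k)
  case 0
  thus ?case by (auto simp: append_cols_def)
next
  case (Suc k)
  have "block_row n V (Suc k) \<in> carrier_mat n (Suc k * p)" "V (Suc (Suc k)) \<in> carrier_mat n p"
    using Suc.prems(1) by (auto intro!: block_row_carrier simp del: block_row.simps mult_Suc)
  moreover have "c < Suc k * p" using Suc.prems(3) by simp
  ultimately have "block_row n V (Suc (Suc k)) $$ (r, c) = block_row n V (Suc k) $$ (r, c)"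
    using Suc.prems(2) unfolding block_row.simps(2)[of n V "Suc k"]
    by (auto simp: append_cols_def simp del: block_row.simps mult_Suc)
  also have "\<dots> = V 1 $$ (r, c)" using Suc.prems by (intro Suc.IH) auto
  finally show ?case .
qed

lemma block_row_mult_first:
  fixes V :: "nat \<Rightarrow> real mat"
  assumes V: "\<forall>j\<in>{1..Suc m}. V j \<in> carrier_mat n p"
  shows "block_row n V (Suc m) * block_unit (Suc m) p 1 = V 1"
proof (rule eq_matI)
  let ?W = "block_row n V (Suc m)" and ?E = "block_unit (Suc m) p 1 :: real mat"
  have W: "?W \<in> carrier_mat n (Suc m * p)" using block_row_carrier[OF V] .
  have V1: "V 1 \<in> carrier_mat n p" using V by auto
  fix r c assume "r < dim_row (V 1)" "c < dim_col (V 1)"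
  hence rc: "r < n" "c < p" using V1 by auto
  have E: "?E \<in> carrier_mat (Suc m * p) p" by (rule block_unit_carrier)
  have colE: "col ?E c = unit_vec (Suc m * p) c"
    using rc by (intro eq_vecI) (auto simp: block_unit_def unit_vec_def)
  have "c < Suc m * p" using rc by simp
  have "(?W * ?E) $$ (r, c) = row ?W r \<bullet> unit_vec (Suc m * p) c"
    unfolding colE[symmetric] using rc carrier_matD[OF W] carrier_matD[OF E]
    by (simp del: block_row.simps mult_Suc)
  also have "\<dots> = ?W $$ (r, c)"
    using scalar_prod_right_unit[OF \<open>c < Suc m * p\<close>, of "row ?W r"] rc \<open>c < Suc m * p\<close> carrier_matD[OF W]
    by (simp del: block_row.simps mult_Suc)
  also have "\<dots> = V 1 $$ (r, c)" by (rule index_block_row_first[OF V rc])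
  finally show "(?W * ?E) $$ (r, c) = V 1 $$ (r, c)" .
next
  have V1: "V 1 \<in> carrier_mat n p" using V by auto
  show "dim_row (block_row n V (Suc m) * block_unit (Suc m) p 1) = dim_row (V 1)"
    "dim_col (block_row n V (Suc m) * block_unit (Suc m) p 1) = dim_col (V 1)"
    using carrier_matD[OF block_row_carrier[OF V]] carrier_matD[OF block_unit_carrier[of "Suc m" p 1]]
      carrier_matD[OF V1] by (simp_all del: block_row.simps mult_Suc)
qed

lemma block_row_mult_I_ext:
  fixes V :: "nat \<Rightarrow> real mat"
  assumes V: "\<forall>j\<in>{1..Suc m}. V j \<in> carrier_mat n p"
  shows "block_row n V (Suc m) * I_ext m p = block_row n V m"
proof -
  have W: "block_row n V m \<in> carrier_mat n (m * p)" using V by (intro block_row_carrier) auto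
  have V': "V (Suc m) \<in> carrier_mat n p" using V by auto
  show ?thesis
    unfolding block_row.simps I_ext_def append_cols_mult[OF W V' one_carrier_mat zero_carrier_mat]
    using W V' by simp
qed

lemma cmat_mult:
  "A \<in> carrier_mat n k \<Longrightarrow> B \<in> carrier_mat k l \<Longrightarrow> cmat (A * B) = cmat A * cmat B"
  by (rule of_real_hom.mat_hom_mult)

text \<open>The transpose of a matrix with orthonormal columns is a left inverse, and stays one after
  passing to the complex numbers.\<close>

lemma orthonormal_cols_cancel:
  assumes W: "W \<in> carrier_mat n k" and orth: "orthonormal_cols W"
    and X: "X \<in> carrier_mat k l" and Y: "Y \<in> carrier_mat k l"
    and eq: "cmat W * X = cmat W * Y"
  shows "X = Y"
proof -
  have "W\<^sup>T * W = 1\<^sub>m k"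
    using W orth by (intro eq_matI) (auto simp: orthonormal_cols_def)
  hence one: "cmat (W\<^sup>T) * cmat W = 1\<^sub>m k"
    using cmat_mult[of "W\<^sup>T" k n W k] W by (simp add: of_real_hom.mat_hom_one)
  have cW: "cmat W \<in> carrier_mat n k" "cmat (W\<^sup>T) \<in> carrier_mat k n" using W by auto
  have "cmat (W\<^sup>T) * (cmat W * M) = M" if M: "M \<in> carrier_mat k l" for M
    unfolding assoc_mult_mat[OF cW(2,1) M, symmetric] one using M by simp
  with X Y eq show ?thesis by metis
qed

lemma H_ext_carrier:
  "H \<in> carrier_mat (m * p) (m * p) \<Longrightarrow> h \<in> carrier_mat p p \<Longrightarrow>
    H_ext m p H h \<in> carrier_mat (m * p + p) (m * p)"
  unfolding H_ext_def by (rule carrier_append_rows) auto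

lemma shifted_ext_eq:
  assumes H: "H \<in> carrier_mat (m * p) (m * p)" and h: "h \<in> carrier_mat p p"
  shows "shifted_ext m p H h t
    = shifted m p H t @\<^sub>r (- t \<cdot>\<^sub>m cmat (h * (block_unit m p m)\<^sup>T))"
proof -
  have "h * (block_unit m p m)\<^sup>T \<in> carrier_mat p (m * p)"
    using h by (intro mult_carrier_mat) auto
  \<comment> \<open>An opaque name for the product keeps the entrywise comparison from expanding it.\<close>
  then obtain M where M: "M = h * (block_unit m p m)\<^sup>T" "M \<in> carrier_mat p (m * p)" by blast
  show ?thesis unfolding shifted_ext_def shifted_def I_ext_def H_ext_def M(1)[symmetric]
    using M(2) H by (intro eq_matI) (auto simp: append_rows_def)
qed

lemma small_residual_eq:
  assumes m: "1 \<le> m" and R: "R \<in> carrier_mat p p"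
    and H: "H \<in> carrier_mat (m * p) (m * p)" and h: "h \<in> carrier_mat p p"
  shows "small_residual m p H h t R Z = (block_unit m p 1 * R @\<^sub>r 0\<^sub>m p p)
    - (shifted m p H t @\<^sub>r (- t \<cdot>\<^sub>m cmat (h * (block_unit m p m)\<^sup>T))) * Z"
  unfolding small_residual_def shifted_ext_eq[OF H h] block_unit_first_extend[OF m]
    append_rows_mult[OF block_unit_carrier zero_carrier_mat R] left_mult_zero_mat[OF R] ..

text \<open>The initial residual is \<open>V\<^sub>1 R = \<V>\<^bsub>m+1\<^esub> E\<^sub>1 R\<close>, where \<open>E\<^sub>1\<close> is the extended unit block,
  and by the Arnoldi relation the system matrix maps \<open>\<V>\<^sub>m Z\<close> to \<open>\<V>\<^bsub>m+1\<^esub>\<close> times the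
  extended shifted matrix times \<open>Z\<close>. So the residual is determined by its projected counterpart.\<close>

lemma residual_arnoldi:
  assumes arnoldi: "block_arnoldi n p m A V H h"
    and A: "A \<in> carrier_mat n n" "invertible_mat A" and B: "B \<in> carrier_mat n p"
    and Y0: "Y0 \<in> carrier_mat n p" and R: "R \<in> carrier_mat p p"
    and init: "residual n A B t Y0 = cmat (V 1) * R"
    and Z: "Z \<in> carrier_mat (m * p) p"
  shows "residual n A B t (Y0 + cmat (block_row n V m) * Z)
    = cmat (block_row n V (Suc m)) * small_residual m p H h t R Z"
proof -
  let ?C = "cmat (minv A)" and ?V = "cmat (block_row n V m)" and ?W = "cmat (block_row n V (Suc m))"
  let ?J = "I_ext m p :: complex mat" and ?K = "cmat (H_ext m p H h)"
  have V: "\<forall>j\<in>{1..Suc m}. V j \<in> carrier_mat n p" and H: "H \<in> carrier_mat (m * p) (m * p)"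
    and h: "h \<in> carrier_mat p p"
    and rel: "minv A * block_row n V m = block_row n V (Suc m) * H_ext m p H h"
    using arnoldi unfolding block_arnoldi_def by blast+
  have N: "Suc m * p = m * p + p" by simp
  have W: "block_row n V (Suc m) \<in> carrier_mat n (m * p + p)"
    using block_row_carrier[OF V] unfolding N .
  have Vm: "block_row n V m \<in> carrier_mat n (m * p)" using V by (intro block_row_carrier) auto
  note Hx = H_ext_carrier[OF H h] and Ai = minv_carrier[OF A]
  have cW: "?W \<in> carrier_mat n (m * p + p)" and cV: "?V \<in> carrier_mat n (m * p)"
    and cK: "?K \<in> carrier_mat (m * p + p) (m * p)" and cC: "?C \<in> carrier_mat n n"
    using W Vm Hx Ai by simp_all
  have IJ: "(I_ext m p :: real mat) \<in> carrier_mat (m * p + p) (m * p)"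
    unfolding I_ext_def by (rule carrier_append_rows[OF one_carrier_mat zero_carrier_mat])
  have cJ: "?J \<in> carrier_mat (m * p + p) (m * p)"
    unfolding I_ext_def by (rule carrier_append_rows[OF one_carrier_mat zero_carrier_mat])
  have mapJ: "cmat (I_ext m p) = ?J" by (intro eq_matI) (auto simp: I_ext_def append_rows_def)
  have WJ: "?W * ?J = ?V"
    unfolding mapJ[symmetric] cmat_mult[OF W IJ, symmetric] block_row_mult_I_ext[OF V] ..
  have WK: "?W * ?K = ?C * ?V"
    unfolding cmat_mult[OF W Hx, symmetric] cmat_mult[OF Ai Vm, symmetric] rel ..
  have Ec: "(block_unit (Suc m) p 1 :: complex mat) \<in> carrier_mat (m * p + p) p"
    and Er: "(block_unit (Suc m) p 1 :: real mat) \<in> carrier_mat (m * p + p) p"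
    using block_unit_carrier[of "Suc m" p 1] unfolding N by blast+
  have "?W * block_unit (Suc m) p 1 = cmat (block_row n V (Suc m) * block_unit (Suc m) p 1)"
    unfolding cmat_mult[OF W Er] by (simp add: map_block_unit del: block_row.simps)
  hence WE: "?W * block_unit (Suc m) p 1 = cmat (V 1)"
    unfolding block_row_mult_first[OF V] .
  let ?D = "1\<^sub>m n - t \<cdot>\<^sub>m ?C"
  have D: "?D \<in> carrier_mat n n" using cC by (intro minus_carrier_mat) simp
  have VZ: "?V * Z \<in> carrier_mat n p" and JZ: "?J * Z \<in> carrier_mat (m * p + p) p"
    and KZ: "?K * Z \<in> carrier_mat (m * p + p) p"
    using mult_carrier_mat[OF cV Z] mult_carrier_mat[OF cJ Z] mult_carrier_mat[OF cK Z] .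
  have tC: "t \<cdot>\<^sub>m ?C \<in> carrier_mat n n" and tK: "t \<cdot>\<^sub>m ?K \<in> carrier_mat (m * p + p) (m * p)"
    and tKZ: "t \<cdot>\<^sub>m (?K * Z) \<in> carrier_mat (m * p + p) p" using cC cK KZ by simp_all
  have CVZ: "?C * (?V * Z) = ?W * (?K * Z)"
    unfolding assoc_mult_mat[OF cC cV Z, symmetric] WK[symmetric] by (rule assoc_mult_mat[OF cW cK Z])
  have VZ_eq: "?V * Z = ?W * (?J * Z)"
    unfolding WJ[symmetric] by (rule assoc_mult_mat[OF cW cJ Z])
  have "?D * (?V * Z) = ?V * Z - t \<cdot>\<^sub>m (?C * (?V * Z))"
    unfolding minus_mult_distrib_mat[OF one_carrier_mat tC VZ] mult_smult_assoc_mat[OF cC VZ]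
      left_mult_one_mat[OF VZ] ..
  also have "\<dots> = ?W * (?J * Z) - t \<cdot>\<^sub>m (?W * (?K * Z))"
    by (simp only: CVZ) (simp only: VZ_eq)
  also have "\<dots> = ?W * (?J * Z - t \<cdot>\<^sub>m (?K * Z))"
    unfolding mult_minus_distrib_mat[OF cW JZ tKZ] mult_smult_distrib[OF cW KZ] ..
  also have "?J * Z - t \<cdot>\<^sub>m (?K * Z) = shifted_ext m p H h t * Z"
    unfolding shifted_ext_def minus_mult_distrib_mat[OF cJ tK Z] mult_smult_assoc_mat[OF cK Z] ..
  finally have DVZ: "?D * (?V * Z) = ?W * (shifted_ext m p H h t * Z)" .
  have sx: "shifted_ext m p H h t \<in> carrier_mat (m * p + p) (m * p)"
    unfolding shifted_ext_def by (rule minus_carrier_mat[OF tK])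
  have "residual n A B t (Y0 + ?V * Z) = cmat B - (?D * Y0 + ?D * (?V * Z))"
    unfolding residual_def mult_add_distrib_mat[OF D Y0 VZ] ..
  also have "\<dots> = residual n A B t Y0 - ?D * (?V * Z)"
    unfolding residual_def
    using B carrier_matD[OF mult_carrier_mat[OF D Y0]] carrier_matD[OF mult_carrier_mat[OF D VZ]]
    by (intro eq_matI) (auto simp del: index_mult_mat)
  also have "\<dots> = ?W * (block_unit (Suc m) p 1 * R) - ?W * (shifted_ext m p H h t * Z)"
    unfolding init DVZ WE[symmetric] assoc_mult_mat[OF cW Ec R] ..
  also have "\<dots> = ?W * small_residual m p H h t R Z"
    unfolding small_residual_def
      mult_minus_distrib_mat[OF cW mult_carrier_mat[OF Ec R] mult_carrier_mat[OF sx Z]] ..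
  finally show ?thesis .
qed


section \<open>Shifted block FOM and GMRES\<close>

text \<open>Both sides equal \<open>|t|\<^sup>2 L\<^sup>H L\<close> with \<open>L = h E\<^sub>m\<^sup>T\<close>: the factor \<open>S\<^sup>H\<close> cancels the inverse in
  \<open>\<Gamma>1\<close>, and since \<open>h\<close> is real, \<open>L\<^sup>H\<close> is \<open>E\<^sub>m h\<^sup>T\<close>.\<close>

lemma seed_factorization:
  fixes S :: "complex mat" and h :: "real mat" and t :: complex
  assumes S: "S \<in> carrier_mat (m * p) (m * p)" "invertible_mat S" and h: "h \<in> carrier_mat p p"
    and m: "1 \<le> m"
  defines "\<Gamma>1 \<equiv> complex_of_real ((cmod t)\<^sup>2) \<cdot>\<^sub>m (minv (mat_adjoint S) * block_unit m p m)"
    and "\<Gamma>2T \<equiv> cmat (h\<^sup>T * h * (block_unit m p m)\<^sup>T)"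
    and "K \<equiv> - t \<cdot>\<^sub>m cmat (h * (block_unit m p m)\<^sup>T)"
  shows "mat_adjoint S * (\<Gamma>1 * \<Gamma>2T) = mat_adjoint K * K"
proof -
  let ?N = "m * p" and ?c = "complex_of_real ((cmod t)\<^sup>2)"
  let ?E = "block_unit m p m :: complex mat" and ?Er = "block_unit m p m :: real mat"
  have Sa: "mat_adjoint S \<in> carrier_mat ?N ?N" using S by simp
  note invSa = invertible_mat_adjoint[OF S]
  note Sai = minv_carrier[OF Sa invSa]
  have E: "?E \<in> carrier_mat ?N p" and Er: "?Er \<in> carrier_mat ?N p" "?Er\<^sup>T \<in> carrier_mat p ?N" by simp_all
  have hT: "h\<^sup>T \<in> carrier_mat p p" using h by simp
  have hE: "h * ?Er\<^sup>T \<in> carrier_mat p ?N" using mult_carrier_mat[OF h Er(2)] .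
  let ?L = "cmat (h * ?Er\<^sup>T)"
  have L: "?L \<in> carrier_mat p ?N" and La: "mat_adjoint ?L \<in> carrier_mat ?N p" using hE by simp_all
  have \<Gamma>2: "\<Gamma>2T = cmat (h\<^sup>T) * ?L"
    unfolding \<Gamma>2T_def assoc_mult_mat[OF hT h Er(2)] by (rule cmat_mult[OF hT hE])
  have cE: "cmat ?Er = ?E" using m by (intro map_block_unit) auto
  have "mat_adjoint ?L = cmat (?Er * h\<^sup>T)"
    unfolding mat_adjoint_cmat transpose_mult[OF h Er(2)] by simp
  also have "\<dots> = ?E * cmat (h\<^sup>T)" unfolding cmat_mult[OF Er(1) hT] cE ..
  finally have La_eq: "mat_adjoint ?L = ?E * cmat (h\<^sup>T)" .
  have chT: "cmat (h\<^sup>T) \<in> carrier_mat p p" using hT by simp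
  have \<Gamma>2c: "\<Gamma>2T \<in> carrier_mat p ?N" unfolding \<Gamma>2 by (rule mult_carrier_mat[OF chT L])
  note SE = mult_carrier_mat[OF Sai E] and E\<Gamma> = mult_carrier_mat[OF E \<Gamma>2c]
  have "mat_adjoint S * (\<Gamma>1 * \<Gamma>2T) = ?c \<cdot>\<^sub>m (mat_adjoint S * (minv (mat_adjoint S) * (?E * \<Gamma>2T)))"
    unfolding \<Gamma>1_def mult_smult_assoc_mat[OF SE \<Gamma>2c] assoc_mult_mat[OF Sai E \<Gamma>2c]
      mult_smult_distrib[OF Sa mult_carrier_mat[OF Sai E\<Gamma>]] ..
  also have "\<dots> = ?c \<cdot>\<^sub>m (?E * \<Gamma>2T)"
    unfolding minv_mult_cancel(2)[OF Sa invSa E\<Gamma>] ..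
  also have "\<dots> = ?c \<cdot>\<^sub>m (mat_adjoint ?L * ?L)"
    unfolding \<Gamma>2 La_eq assoc_mult_mat[OF E chT L] ..
  also have "?c = cnj (- t) * - t"
    by (simp only: complex_norm_square complex_cnj_minus minus_mult_minus mult.commute)
  also have "(cnj (- t) * - t) \<cdot>\<^sub>m (mat_adjoint ?L * ?L) = mat_adjoint K * K"
    unfolding K_def mat_adjoint_smult mult_smult_assoc_mat[OF La smult_carrier_mat[OF L]]
      mult_smult_distrib[OF La L]
    by (intro eq_matI) (simp_all add: mult.assoc del: index_mult_mat(1))
  finally show ?thesis .
qed

theorem theorem4p1:
  fixes n p m \<nu> :: nat
    and A B H h :: "real mat"
    and V :: "nat \<Rightarrow> real mat"
    and \<tau> :: "nat \<Rightarrow> complex"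
    and R Y0 Y_FOM Y_GMRES Z_FOM Z_GMRES \<Omega> :: "nat \<Rightarrow> complex mat"
    and G1 \<Psi>1 \<Psi>2 \<Psi>3T \<Gamma>1 \<Gamma>2T :: "complex mat"
  assumes dims: "1 \<le> p" "1 \<le> m" "1 \<le> \<nu>"
    and A: "A \<in> carrier_mat n n" "invertible_mat A"
    and B: "B \<in> carrier_mat n p"
    and shifts: "\<forall>i\<in>{1..\<nu>}. invertible_mat (cmat A - \<tau> i \<cdot>\<^sub>m 1\<^sub>m n)"
    and arnoldi: "block_arnoldi n p m A V H h"
    and init: "\<forall>i\<in>{1..\<nu>}. Y0 i \<in> carrier_mat n p \<and> R i \<in> carrier_mat p p \<and>
                 residual n A B (\<tau> i) (Y0 i) = cmat (V 1) * R i"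
    and fom: "\<forall>i\<in>{1..\<nu>}. Z_FOM i = fom_coeff m p H (\<tau> i) (R i) \<and>
                Y_FOM i = Y0 i + cmat (block_row n V m) * Z_FOM i"
    and gmres: "\<forall>i\<in>{1..\<nu>}. Z_GMRES i \<in> carrier_mat (m * p) p \<and>
                  Y_GMRES i = Y0 i + cmat (block_row n V m) * Z_GMRES i"
    and seed: "is_seed_gmres_coeff m p H h (\<tau> 1) (R 1) (Z_GMRES 1)"
    and additional: "\<forall>i\<in>{2..\<nu>}. collinear_residuals p
                       (residual n A B (\<tau> 1) (Y_GMRES 1)) (residual n A B (\<tau> i) (Y_GMRES i))"
    and nonsing: "\<forall>i\<in>{1..\<nu>}. invertible_mat (shifted m p H (\<tau> i))"
    and G1: "G1 = small_residual m p H h (\<tau> 1) (R 1) (Z_GMRES 1)"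
    and \<Psi>12: "\<Psi>1 \<in> carrier_mat (m * p) p" "\<Psi>2 \<in> carrier_mat p p" "G1 = \<Psi>1 @\<^sub>r \<Psi>2"
    and \<Psi>2_nonsing: "invertible_mat \<Psi>2"
    and aug_nonsing: "\<forall>i\<in>{2..\<nu>}. invertible_mat (shifted_ext m p H h (\<tau> i) @\<^sub>c G1)"
    and \<Gamma>1: "\<Gamma>1 = complex_of_real ((cmod (\<tau> 1))\<^sup>2) \<cdot>\<^sub>m
                  (minv (mat_adjoint (shifted m p H (\<tau> 1))) * block_unit m p m)"
    and \<Gamma>2T: "\<Gamma>2T = cmat (h\<^sup>T * h * (block_unit m p m)\<^sup>T)"
    and \<Psi>3T: "\<Psi>3T = minv \<Psi>2 * cmat (h * (block_unit m p m)\<^sup>T)"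
    and \<Omega>1: "\<Omega> 1 = minv (shifted m p H (\<tau> 1)) * \<Gamma>1 *
                 minv (1\<^sub>m p + \<Gamma>2T * minv (shifted m p H (\<tau> 1)) * \<Gamma>1) * \<Gamma>2T"
    and \<Omega>i: "\<forall>i\<in>{2..\<nu>}. \<Omega> i = \<tau> i \<cdot>\<^sub>m (minv (shifted m p H (\<tau> i)) * \<Psi>1 *
                 minv (1\<^sub>m p + \<tau> i \<cdot>\<^sub>m (\<Psi>3T * minv (shifted m p H (\<tau> i)) * \<Psi>1)) * \<Psi>3T)"
  shows "invertible_mat (1\<^sub>m p + \<Gamma>2T * minv (shifted m p H (\<tau> 1)) * \<Gamma>1) \<and>
         Z_GMRES 1 = (1\<^sub>m (m * p) - \<Omega> 1) * Z_FOM 1 \<and>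
         (\<forall>i\<in>{2..\<nu>}.
            invertible_mat (1\<^sub>m p + \<tau> i \<cdot>\<^sub>m (\<Psi>3T * minv (shifted m p H (\<tau> i)) * \<Psi>1)) \<and>
            Z_GMRES i = (1\<^sub>m (m * p) - \<Omega> i) * Z_FOM i)"
proof -
  let ?N = "m * p" and ?E1 = "block_unit m p 1 :: complex mat"
  let ?S = "\<lambda>i. shifted m p H (\<tau> i)" and ?L = "cmat (h * (block_unit m p m)\<^sup>T)"
  have V: "\<forall>j\<in>{1..Suc m}. V j \<in> carrier_mat n p" and H: "H \<in> carrier_mat ?N ?N"
    and h: "h \<in> carrier_mat p p" and orth: "orthonormal_cols (block_row n V (Suc m))"
    using arnoldi unfolding block_arnoldi_def by blast+
  have S: "?S i \<in> carrier_mat ?N ?N" for i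
    unfolding shifted_def using H by (intro minus_carrier_mat) simp
  have inv: "invertible_mat (?S i)" if "i \<in> {1..\<nu>}" for i using nonsing that by blast
  have R: "R i \<in> carrier_mat p p" if "i \<in> {1..\<nu>}" for i using init that by blast
  have L: "?L \<in> carrier_mat p ?N"
    using mult_carrier_mat[OF h, of "(block_unit m p m)\<^sup>T" ?N] by simp
  have K: "- t \<cdot>\<^sub>m ?L \<in> carrier_mat p ?N" for t using L by simp
  have E1: "?E1 \<in> carrier_mat ?N p" by simp
  have Z_FOM: "Z_FOM i = minv (?S i) * (?E1 * R i)" if i: "i \<in> {1..\<nu>}" for i
    using fom i assoc_mult_mat[OF minv_carrier[OF S inv[OF i]] E1 R[OF i]]
    by (simp add: fom_coeff_def)
  have one: "1 \<in> {1..\<nu>}" using dims by simp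
  note small = small_residual_eq[OF dims(2) R H h]

  note Si1 = minv_carrier[OF S inv[OF one]]
  have \<Gamma>1c: "\<Gamma>1 \<in> carrier_mat ?N p"
    unfolding \<Gamma>1 using minv_carrier[OF mat_adjoint_carrier[OF S] invertible_mat_adjoint[OF S inv[OF one]]]
    by (intro smult_carrier_mat mult_carrier_mat[OF _ block_unit_carrier])
  have \<Gamma>2c: "\<Gamma>2T \<in> carrier_mat p ?N"
    unfolding \<Gamma>2T using h by (simp add: mult_carrier_mat[of _ p p _ ?N])
  have min: "is_arg_min (\<lambda>X. frob_norm ((?E1 * R 1 @\<^sub>r 0\<^sub>m p p) - (?S 1 @\<^sub>r (- \<tau> 1 \<cdot>\<^sub>m ?L)) * X))
      (\<lambda>X. X \<in> carrier_mat ?N p) (Z_GMRES 1)"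
    using seed unfolding is_seed_gmres_coeff_def small[OF one] .
  note seed_sol = seed_solution[OF S inv[OF one] K \<Gamma>1c \<Gamma>2c
      seed_factorization[OF S inv[OF one] h dims(2), of "\<tau> 1", folded \<Gamma>1 \<Gamma>2T]
      mult_carrier_mat[OF E1 R[OF one]] min]
  have seed_assoc: "\<Gamma>2T * minv (?S 1) * \<Gamma>1 = \<Gamma>2T * (minv (?S 1) * \<Gamma>1)"
    by (rule assoc_mult_mat[OF \<Gamma>2c Si1 \<Gamma>1c])

  have add: "invertible_mat (1\<^sub>m p + \<tau> i \<cdot>\<^sub>m (\<Psi>3T * minv (?S i) * \<Psi>1)) \<and>
      Z_GMRES i = (1\<^sub>m ?N - \<Omega> i) * Z_FOM i" if i2: "i \<in> {2..\<nu>}" for i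
  proof -
    have i: "i \<in> {1..\<nu>}" using i2 by simp
    note Si = minv_carrier[OF S inv[OF i]]
    let ?W = "block_row n V (Suc m)"
    have W: "?W \<in> carrier_mat n (?N + p)" using block_row_carrier[OF V] by (simp add: add.commute)
    have res: "residual n A B (\<tau> j) (Y_GMRES j) = cmat ?W * small_residual m p H h (\<tau> j) (R j) (Z_GMRES j)"
      if j: "j \<in> {1..\<nu>}" for j
    proof -
      have Y: "Y_GMRES j = Y0 j + cmat (block_row n V m) * Z_GMRES j" using gmres j by blast
      show ?thesis unfolding Y by (rule residual_arnoldi[OF arnoldi A B]) (use init gmres j in blast)+
    qed
    obtain C where C: "C \<in> carrier_mat p p"
      and coll: "residual n A B (\<tau> i) (Y_GMRES i) = residual n A B (\<tau> 1) (Y_GMRES 1) * C"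
      using additional i2 unfolding collinear_residuals_def by blast
    have G1c: "G1 \<in> carrier_mat (?N + p) p"
      unfolding \<Psi>12(3) by (rule carrier_append_rows[OF \<Psi>12(1,2)])
    have Zi: "Z_GMRES i \<in> carrier_mat ?N p" using gmres i by blast
    have sm: "small_residual m p H h (\<tau> i) (R i) (Z_GMRES i) \<in> carrier_mat (?N + p) p"
      unfolding small[OF i]
      by (rule minus_carrier_mat[OF mult_carrier_mat[OF carrier_append_rows[OF S K] Zi]])
    have "cmat ?W * small_residual m p H h (\<tau> i) (R i) (Z_GMRES i) = cmat ?W * (G1 * C)"
      using coll unfolding res[OF i] res[OF one] G1[symmetric]
      using assoc_mult_mat[of "cmat ?W" n "?N + p" G1 p C p] W G1c C
      by (simp del: block_row.simps)
    hence "small_residual m p H h (\<tau> i) (R i) (Z_GMRES i) = G1 * C"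
      by (rule orthonormal_cols_cancel[OF W orth sm mult_carrier_mat[OF G1c C]])
    hence eq: "(?E1 * R i @\<^sub>r 0\<^sub>m p p) - (?S i @\<^sub>r (- \<tau> i \<cdot>\<^sub>m ?L)) * Z_GMRES i = (\<Psi>1 @\<^sub>r \<Psi>2) * C"
      unfolding small[OF i] \<Psi>12(3) .
    have aug: "invertible_mat ((?S i @\<^sub>r (- \<tau> i \<cdot>\<^sub>m ?L)) @\<^sub>c (\<Psi>1 @\<^sub>r \<Psi>2))"
      using aug_nonsing i2 unfolding shifted_ext_eq[OF H h] \<Psi>12(3) by blast
    note sol = collinear_solution[OF S inv[OF i] L \<Psi>12(1,2) \<Psi>2_nonsing aug
        mult_carrier_mat[OF E1 R[OF i]] Zi C eq, folded \<Psi>3T]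
    let ?U = "\<tau> i \<cdot>\<^sub>m (minv (?S i) * \<Psi>1)"
    have P3: "\<Psi>3T \<in> carrier_mat p ?N"
      unfolding \<Psi>3T by (rule mult_carrier_mat[OF minv_carrier[OF \<Psi>12(2) \<Psi>2_nonsing] L])
    have S\<Psi>: "minv (?S i) * \<Psi>1 \<in> carrier_mat ?N p" by (rule mult_carrier_mat[OF Si \<Psi>12(1)])
    have M: "1\<^sub>m p + \<tau> i \<cdot>\<^sub>m (\<Psi>3T * minv (?S i) * \<Psi>1) = 1\<^sub>m p + \<Psi>3T * ?U"
      unfolding mult_smult_distrib[OF P3 S\<Psi>] assoc_mult_mat[OF P3 Si \<Psi>12(1)] ..
    have Mi: "minv (1\<^sub>m p + \<Psi>3T * ?U) \<in> carrier_mat p p"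
      using P3 S\<Psi> by (intro minv_carrier[OF _ sol(1)] add_carrier_mat mult_carrier_mat[OF P3]) simp
    have "\<Omega> i = \<tau> i \<cdot>\<^sub>m (minv (?S i) * \<Psi>1 * minv (1\<^sub>m p + \<Psi>3T * ?U) * \<Psi>3T)"
      using \<Omega>i i2 unfolding M[symmetric] by blast
    also have "\<dots> = ?U * minv (1\<^sub>m p + \<Psi>3T * ?U) * \<Psi>3T"
      unfolding mult_smult_assoc_mat[OF S\<Psi> Mi] mult_smult_assoc_mat[OF mult_carrier_mat[OF S\<Psi> Mi] P3] ..
    finally show ?thesis unfolding M Z_FOM[OF i] using sol by simp
  qed

  show ?thesis
    unfolding \<Omega>1 seed_assoc Z_FOM[OF one] using seed_sol add by blast
qed

end
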